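(* Let $\mathcal{T} = (T,\tau)$ be a hierarchical tile assembly system. If $\alpha,\beta$ are $\mathcal{T}$-producible assemblies that are consistent and $\mathrm{dom}\,\alpha \cap \mathrm{dom}\,\beta \neq \emptyset$, then $\alpha \cup \beta$ is $\mathcal{T}$-producible. Furthermore, $\alpha \to \alpha \cup \beta$, i.e., there is an assembly tree of $\alpha\cup\beta$ in which $\alpha$ labels a node (so it is possible to assemble exactly $\alpha$, then to assemble the missing portions of $\beta$).
   Context: A tile type is a unit square with, on each of its four sides, a glue label and a nonnegative integer strength. An assembly is a partial function $\alpha:\mathbb{Z}^2 \dashrightarrow T$ with finite nonempty domain whose full grid graph is connected. Two tiles at adjacent positions interact if the glue labels on their abutting sides are equal and of positive strength; the binding graph has vertices $\mathrm{dom}\,\alpha$ and edges between interacting positions, weighted by glue strength; $\alpha$ is $\tau$-stable if every cut of its binding graph has weight at least $\tau$. A hierarchical tile assembly system is a pair $\mathcal{T}=(T,\tau)$ with $T$ a finite set of tile types and $\tau \in \mathbb{Z}^+$. An assembly $\gamma$ is $\mathcal{T}$-producible if either it is a single tile (of a type in $T$), or $\gamma = \alpha \cup \beta$ for producible assemblies $\alpha,\beta$ with disjoint domains and $\gamma$ is $\tau$-stable; write $\alpha + \beta \to_1 \gamma$ in that case. An assembly tree of a producible $\hat\alpha$ is a full binary tree whose nodes are labeled by producible assemblies, with $\hat\alpha$ at the root, single-tile assemblies at the $|\hat\alpha|$ leaves, and each internal node labeled $\gamma$ with children labeled $\alpha,\beta$ satisfying $\alpha+\beta\to_1\gamma$.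 Write $\alpha \to \gamma$ if $\alpha$ is a descendant node of $\gamma$ (or equals it) in some assembly tree. Assemblies $\alpha,\beta$ are consistent if $\alpha(p) = \beta(p)$ for all $p \in \mathrm{dom}\,\alpha \cap \mathrm{dom}\,\beta$; then $\alpha\cup\beta$ is the assembly with domain $\mathrm{dom}\,\alpha \cup \mathrm{dom}\,\beta$ agreeing with $\alpha$ on $\mathrm{dom}\,\alpha$ and with $\beta$ on $\mathrm{dom}\,\beta$. *)

theory Defs
  imports "Graph_Theory.Digraph_Component"
begin

datatype direction = North | East | South | West

fun opposite :: "direction \<Rightarrow> direction" where
  "opposite North = South"
| "opposite East = West"
| "opposite South = North"
| "opposite West = East"

type_synonym position = "int \<times> int"

fun neighbor :: "direction \<Rightarrow> position \<Rightarrow> position" where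
  "neighbor North (x, y) = (x, y + 1)"
| "neighbor East (x, y) = (x + 1, y)"
| "neighbor South (x, y) = (x, y - 1)"
| "neighbor West (x, y) = (x - 1, y)"

definition adjacent :: "position \<Rightarrow> position \<Rightarrow> bool" where
  "adjacent p q \<longleftrightarrow> (\<exists>d. q = neighbor d p)"

text \<open>The side of a tile at \<^term>\<open>p\<close> that abuts the position \<^term>\<open>q\<close>; only meaningful if
  \<^term>\<open>p\<close> and \<^term>\<open>q\<close> are adjacent, in which case the direction is unique.\<close>

definition side_towards :: "position \<Rightarrow> position \<Rightarrow> direction" where
  "side_towards p q = (THE d. q = neighbor d p)"

datatype 'l tile = Tile (glue_label: "direction \<Rightarrow> 'l") (glue_strength: "direction \<Rightarrow> nat")

type_synonym 'l placement = "position \<rightharpoonup> 'l tile"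

text \<open>Undirected graphs are represented by symmetric sets of arcs.\<close>

definition grid_graph :: "'l placement \<Rightarrow> position pair_pre_digraph" where
  "grid_graph \<alpha> =
     \<lparr> pverts = dom \<alpha>, parcs = {(p, q). p \<in> dom \<alpha> \<and> q \<in> dom \<alpha> \<and> adjacent p q} \<rparr>"

definition assembly :: "'l placement \<Rightarrow> bool" where
  "assembly \<alpha> \<longleftrightarrow> finite (dom \<alpha>) \<and> dom \<alpha> \<noteq> {} \<and> connected (with_proj (grid_graph \<alpha>))"

definition interact :: "'l placement \<Rightarrow> position \<Rightarrow> position \<Rightarrow> bool" where
  "interact \<alpha> p q \<longleftrightarrow>
     adjacent p q \<and>
     (\<exists>s t. \<alpha> p = Some s \<and> \<alpha> q = Some t \<and>
        glue_label s (side_towards p q) = glue_label t (side_towards q p) \<and>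
        glue_strength s (side_towards p q) > 0 \<and>
        glue_strength t (side_towards q p) > 0)"

definition binding_graph :: "'l placement \<Rightarrow> position pair_pre_digraph" where
  "binding_graph \<alpha> = \<lparr> pverts = dom \<alpha>, parcs = {(p, q). interact \<alpha> p q} \<rparr>"

text \<open>The weight of an edge of the binding graph. The two abutting glues have the same label;
  in the usual situation, where the label of a glue determines its strength, they also
  have the same strength, and the minimum is that common strength. Tile types that
  assign different strengths to the same label are not excluded; for those
  the weaker of the two abutting glues counts.\<close>

definition bond_strength :: "'l placement \<Rightarrow> position \<Rightarrow> position \<Rightarrow> nat" where
  "bond_strength \<alpha> p q =
     min (glue_strength (the (\<alpha> p)) (side_towards p q))
         (glue_strength (the (\<alpha> q)) (side_towards q p))"

text \<open>The weight of the cut separating \<^term>\<open>X\<close> from the remaining vertices. An undirected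
  edge crossing the cut is counted once, by its arc that leaves \<^term>\<open>X\<close>.\<close>

definition cut_weight :: "'l placement \<Rightarrow> position set \<Rightarrow> nat" where
  "cut_weight \<alpha> X =
     (\<Sum>(p, q) \<in> parcs (binding_graph \<alpha>) \<inter> X \<times> (pverts (binding_graph \<alpha>) - X).
        bond_strength \<alpha> p q)"

definition stable :: "nat \<Rightarrow> 'l placement \<Rightarrow> bool" where
  "stable \<tau> \<alpha> \<longleftrightarrow>
     (\<forall>X. X \<noteq> {} \<and> X \<subset> pverts (binding_graph \<alpha>) \<longrightarrow> \<tau> \<le> cut_weight \<alpha> X)"

definition hierarchical_TAS :: "'l tile set \<Rightarrow> nat \<Rightarrow> bool" where
  "hierarchical_TAS T \<tau> \<longleftrightarrow> finite T \<and> \<tau> > 0"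

definition consistent :: "'l placement \<Rightarrow> 'l placement \<Rightarrow> bool" where
  "consistent \<alpha> \<beta> \<longleftrightarrow> (\<forall>p \<in> dom \<alpha> \<inter> dom \<beta>. \<alpha> p = \<beta> p)"

definition single_tile :: "'l tile set \<Rightarrow> 'l placement \<Rightarrow> bool" where
  "single_tile T \<alpha> \<longleftrightarrow> (\<exists>p. \<exists>t \<in> T. \<alpha> = [p \<mapsto> t])"

text \<open>The union of consistent \<^term>\<open>\<alpha>\<close> and \<^term>\<open>\<beta>\<close> is \<^term>\<open>\<alpha> ++ \<beta>\<close>; that the operator
  \<open>++\<close> prefers its right argument is then irrelevant.\<close>

inductive producible :: "'l tile set \<Rightarrow> nat \<Rightarrow> 'l placement \<Rightarrow> bool" for T \<tau> where
  single: "single_tile T \<alpha> \<Longrightarrow> producible T \<tau> \<alpha>"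
| union: "\<lbrakk> producible T \<tau> \<alpha>; producible T \<tau> \<beta>; dom \<alpha> \<inter> dom \<beta> = {};
            \<gamma> = \<alpha> ++ \<beta>; assembly \<gamma>; stable \<tau> \<gamma> \<rbrakk> \<Longrightarrow> producible T \<tau> \<gamma>"

text \<open>The relation $\alpha + \beta \to_1 \gamma$.\<close>

definition combines ::
    "'l tile set \<Rightarrow> nat \<Rightarrow> 'l placement \<Rightarrow> 'l placement \<Rightarrow> 'l placement \<Rightarrow> bool" where
  "combines T \<tau> \<alpha> \<beta> \<gamma> \<longleftrightarrow>
     producible T \<tau> \<alpha> \<and> producible T \<tau> \<beta> \<and> dom \<alpha> \<inter> dom \<beta> = {} \<and>
     \<gamma> = \<alpha> ++ \<beta> \<and> assembly \<gamma> \<and> stable \<tau> \<gamma>"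

datatype (node_labels: 'a) full_tree =
  Leaf (root: 'a) | Node (root: 'a) "'a full_tree" "'a full_tree"

primrec num_leaves :: "'a full_tree \<Rightarrow> nat" where
  "num_leaves (Leaf \<alpha>) = 1"
| "num_leaves (Node \<gamma> l r) = num_leaves l + num_leaves r"

primrec well_labeled :: "'l tile set \<Rightarrow> nat \<Rightarrow> 'l placement full_tree \<Rightarrow> bool" where
  "well_labeled T \<tau> (Leaf \<alpha>) \<longleftrightarrow> single_tile T \<alpha>"
| "well_labeled T \<tau> (Node \<gamma> l r) \<longleftrightarrow>
     combines T \<tau> (root l) (root r) \<gamma> \<and> well_labeled T \<tau> l \<and> well_labeled T \<tau> r"

definition assembly_tree ::
    "'l tile set \<Rightarrow> nat \<Rightarrow> 'l placement \<Rightarrow> 'l placement full_tree \<Rightarrow> bool" where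
  "assembly_tree T \<tau> \<gamma> t \<longleftrightarrow>
     root t = \<gamma> \<and> (\<forall>\<alpha> \<in> node_labels t. producible T \<tau> \<alpha>) \<and>
     num_leaves t = card (dom \<gamma>) \<and> well_labeled T \<tau> t"

text \<open>The relation $\alpha \to \gamma$.\<close>

definition assembles_to :: "'l tile set \<Rightarrow> nat \<Rightarrow> 'l placement \<Rightarrow> 'l placement \<Rightarrow> bool" where
  "assembles_to T \<tau> \<alpha> \<gamma> \<longleftrightarrow> (\<exists>t. assembly_tree T \<tau> \<gamma> t \<and> \<alpha> \<in> node_labels t)"

end

(* Growing an assembly tree of \<alpha> along an assembly tree of \<beta>: if \<beta> is the combination of
   \<beta>\<^sub>1 and \<beta>\<^sub>2, one of them, say \<beta>\<^sub>1, overlaps \<alpha>, so by induction \<alpha> grows to \<alpha> \<union> \<beta>\<^sub>1.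
   If \<beta>\<^sub>2 overlaps \<alpha> \<union> \<beta>\<^sub>1, induction applies again. Otherwise \<beta>\<^sub>2 can be attached to
   \<alpha> \<union> \<beta>\<^sub>1 in one step, since the result is the union of the overlapping stable assemblies
   \<alpha> \<union> \<beta>\<^sub>1 and \<beta>, and such a union is stable: every cut of it cuts one of the two. *)

theory Submission
  imports Defs
begin

section \<open>Cuts of binding graphs and stability of overlapping unions\<close>

lemma bond_strength_map_le:
  assumes "\<alpha> \<subseteq>\<^sub>m \<gamma>" "p \<in> dom \<alpha>" "q \<in> dom \<alpha>"
  shows "bond_strength \<alpha> p q = bond_strength \<gamma> p q"
  using assms by (simp add: bond_strength_def map_le_def)

lemma interact_map_le:
  assumes "\<alpha> \<subseteq>\<^sub>m \<gamma>" "interact \<alpha> p q"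
  shows "interact \<gamma> p q"
proof -
  have "\<gamma> r = Some s" if "\<alpha> r = Some s" for r s
    using assms(1) that by (metis domI map_le_def)
  then show ?thesis
    using assms(2) unfolding interact_def by blast
qed

lemma interact_dom: "interact \<alpha> p q \<Longrightarrow> p \<in> dom \<alpha> \<and> q \<in> dom \<alpha>"
  by (auto simp: interact_def)

text \<open>Arcs of \<alpha> crossing the restricted cut start in X and end in
  \<open>dom \<alpha>\<close> outside X, so they cross X in \<gamma> as well, with the same
  strengths. The further arcs of \<gamma> only add nonnegative weight. Finiteness matters because an
  infinite \<open>sum\<close> defaults to 0.\<close>

lemma cut_weight_mono:
  assumes le: "\<alpha> \<subseteq>\<^sub>m \<gamma>" and fin: "finite (dom \<gamma>)"
  shows "cut_weight \<alpha> (X \<inter> dom \<alpha>) \<le> cut_weight \<gamma> X"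
proof -
  let ?cut = "\<lambda>\<delta> Y. parcs (binding_graph \<delta>) \<inter> Y \<times> (pverts (binding_graph \<delta>) - Y)"
  have "cut_weight \<alpha> (X \<inter> dom \<alpha>) =
      (\<Sum>(p, q) \<in> ?cut \<alpha> (X \<inter> dom \<alpha>). bond_strength \<gamma> p q)"
    unfolding cut_weight_def
    by (rule sum.cong) (auto simp: binding_graph_def bond_strength_map_le[OF le] domIff)
  also have "\<dots> \<le> (\<Sum>(p, q) \<in> ?cut \<gamma> X. bond_strength \<gamma> p q)"
  proof (rule sum_mono2)
    have "?cut \<gamma> X \<subseteq> dom \<gamma> \<times> dom \<gamma>"
      by (auto simp: binding_graph_def dest: interact_dom)
    then show "finite (?cut \<gamma> X)"
      using fin by (meson finite_SigmaI finite_subset)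
    show "?cut \<alpha> (X \<inter> dom \<alpha>) \<subseteq> ?cut \<gamma> X"
      using map_le_implies_dom_le[OF le]
      by (auto simp: binding_graph_def intro: interact_map_le[OF le])
  qed auto
  finally show ?thesis
    by (simp add: cut_weight_def)
qed

lemma stable_overlapping_union:
  assumes le: "\<alpha> \<subseteq>\<^sub>m \<gamma>" "\<beta> \<subseteq>\<^sub>m \<gamma>" and dom: "dom \<gamma> = dom \<alpha> \<union> dom \<beta>" "finite (dom \<gamma>)"
    and overlap: "dom \<alpha> \<inter> dom \<beta> \<noteq> {}"
    and stable: "stable \<tau> \<alpha>" "stable \<tau> \<beta>"
  shows "stable \<tau> \<gamma>"
  unfolding stable_def
proof (intro allI impI)
  fix X assume X: "X \<noteq> {} \<and> X \<subset> pverts (binding_graph \<gamma>)"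
  have cut: "\<tau> \<le> cut_weight \<gamma> X"
    if "stable \<tau> \<delta>" "\<delta> \<subseteq>\<^sub>m \<gamma>" "X \<inter> dom \<delta> \<noteq> {}" "\<not> dom \<delta> \<subseteq> X" for \<delta>
  proof -
    have "X \<inter> dom \<delta> \<subset> dom \<delta>"
      using that by blast
    then have "\<tau> \<le> cut_weight \<delta> (X \<inter> dom \<delta>)"
      using that by (simp add: stable_def binding_graph_def)
    also have "\<dots> \<le> cut_weight \<gamma> X"
      using that dom by (intro cut_weight_mono)
    finally show ?thesis .
  qed
  \<comment> \<open>If X cut neither domain, each would lie inside X or miss X. A shared position
    forces the same alternative on both, making X all of \<open>dom \<gamma>\<close> or
    empty.\<close>
  have "(X \<inter> dom \<alpha> \<noteq> {} \<and> \<not> dom \<alpha> \<subseteq> X) \<or> (X \<inter> dom \<beta> \<noteq> {} \<and> \<not> dom \<beta> \<subseteq> X)"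
    using X dom overlap by (simp add: binding_graph_def) blast
  then show "\<tau> \<le> cut_weight \<gamma> X"
    using cut le stable by blast
qed

section \<open>Connectivity of overlapping unions\<close>

lemma wf_grid_graph: "wf_digraph (with_proj (grid_graph \<alpha>))"
  by unfold_locales (auto simp: grid_graph_def)

lemma subgraph_grid_graph:
  assumes "dom \<alpha> \<subseteq> dom \<gamma>"
  shows "subgraph (with_proj (grid_graph \<alpha>)) (with_proj (grid_graph \<gamma>))"
  using assms
  by (intro subgraphI wf_grid_graph) (auto simp: grid_graph_def compatible_def)

lemma assembly_overlapping_union:
  fixes \<alpha> \<beta> \<gamma> :: "'l placement"
  assumes dom: "dom \<gamma> = dom \<alpha> \<union> dom \<beta>" and overlap: "dom \<alpha> \<inter> dom \<beta> \<noteq> {}"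
    and asm: "assembly \<alpha>" "assembly \<beta>"
  shows "assembly \<gamma>"
proof -
  \<comment> \<open>\<open>connected\<close> is defined as strong connectivity of the symmetric
    closure, so reachability is studied there.\<close>
  let ?S = "\<lambda>\<delta>. with_proj (mk_symmetric (with_proj (grid_graph \<delta>)))"
  interpret pair_wf_digraph "mk_symmetric (with_proj (grid_graph \<gamma>))"
    by (rule wf_digraph.wellformed_mk_symmetric[OF wf_grid_graph])
  obtain r where r: "r \<in> dom \<alpha>" "r \<in> dom \<beta>"
    using overlap by auto
  have reach: "u \<rightarrow>\<^sup>*\<^bsub>?S \<gamma>\<^esub> v"
    if "assembly \<delta>" "dom \<delta> \<subseteq> dom \<gamma>" "u \<in> dom \<delta>" "v \<in> dom \<delta>" for \<delta> :: "'l placement" and u v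
  proof (rule pre_digraph.reachable_mono)
    show "u \<rightarrow>\<^sup>*\<^bsub>?S \<delta>\<^esub> v"
      using that by (auto simp: assembly_def connected_def strongly_connected_def grid_graph_def)
    show "subgraph (?S \<delta>) (?S \<gamma>)"
      using that by (intro subgraph_mk_symmetric subgraph_grid_graph)
  qed
  \<comment> \<open>The shared position r is a hub: every position is joined to it within
    \<open>dom \<alpha>\<close> or within \<open>dom \<beta>\<close>.\<close>
  have "u \<rightarrow>\<^sup>*\<^bsub>?S \<gamma>\<^esub> r \<and> r \<rightarrow>\<^sup>*\<^bsub>?S \<gamma>\<^esub> u" if "u \<in> dom \<gamma>" for u
    using that reach[OF asm(1)] reach[OF asm(2)] r dom by blast
  then have "u \<rightarrow>\<^sup>*\<^bsub>?S \<gamma>\<^esub> v" if "u \<in> dom \<gamma>" "v \<in> dom \<gamma>" for u v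
    using that reachable_trans by blast
  then have "strongly_connected (?S \<gamma>)"
    using r dom by (auto simp: strongly_connected_def grid_graph_def)
  then show ?thesis
    using asm dom by (auto simp: assembly_def connected_def)
qed

section \<open>Producible assemblies and their assembly trees\<close>

lemma assembly_single: "assembly [p \<mapsto> t]"
proof -
  have "p \<rightarrow>\<^sup>*\<^bsub>with_proj (mk_symmetric (with_proj (grid_graph [p \<mapsto> t])))\<^esub> p"
    by (auto simp: reachable_def grid_graph_def)
  then show ?thesis
    by (auto simp: assembly_def connected_def strongly_connected_def grid_graph_def)
qed

lemma stable_single: "stable \<tau> [p \<mapsto> t]"
  by (auto simp: stable_def binding_graph_def)

lemma producible_assembly: "producible T \<tau> \<alpha> \<Longrightarrow> assembly \<alpha>"
  by (induction rule: producible.induct) (use assembly_single in \<open>auto simp only: single_tile_def\<close>)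

lemma producible_stable: "producible T \<tau> \<alpha> \<Longrightarrow> stable \<tau> \<alpha>"
  by (induction rule: producible.induct) (use stable_single in \<open>auto simp only: single_tile_def\<close>)

lemma producible_finite: "producible T \<tau> \<alpha> \<Longrightarrow> finite (dom \<alpha>)"
  using producible_assembly by (auto simp: assembly_def)

lemma root_in_node_labels: "root t \<in> node_labels t"
  by (cases t) auto

lemma combines_producible: "combines T \<tau> \<alpha> \<beta> \<gamma> \<Longrightarrow> producible T \<tau> \<gamma>"
  by (auto simp: combines_def intro: producible.union)

text \<open>The other two conditions on an assembly tree come for free: \<open>combines\<close>
  yields producible labels, and it joins disjoint domains, so leaf counts add up like domain
  sizes.\<close>

lemma well_labeled_imp_assembly_tree:
  assumes "well_labeled T \<tau> t"
  shows "assembly_tree T \<tau> (root t) t"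
  using assms
proof (induction t)
  case (Leaf \<alpha>)
  then have single: "single_tile T \<alpha>"
    by simp
  then have "card (dom \<alpha>) = 1"
    unfolding single_tile_def by (elim exE bexE) simp
  with single producible.single[OF single] show ?case
    by (simp add: assembly_tree_def)
next
  case (Node \<gamma> l r)
  then have c: "combines T \<tau> (root l) (root r) \<gamma>"
    and l: "assembly_tree T \<tau> (root l) l" and r: "assembly_tree T \<tau> (root r) r"
    by auto
  have "card (dom \<gamma>) = card (dom (root l)) + card (dom (root r))"
    using c by (auto simp: combines_def card_Un_disjoint producible_finite Int_commute)
  then show ?case
    using l r Node.prems combines_producible[OF c] by (auto simp: assembly_tree_def)
qed

lemma assembly_tree_Node:
  assumes "combines T \<tau> \<alpha> \<beta> \<gamma>" "assembly_tree T \<tau> \<alpha> l" "assembly_tree T \<tau> \<beta> r"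
  shows "assembly_tree T \<tau> \<gamma> (Node \<gamma> l r)"
  using assms well_labeled_imp_assembly_tree[of T \<tau> "Node \<gamma> l r"]
  by (auto simp: assembly_tree_def)

lemma assembly_tree_producible: "assembly_tree T \<tau> \<gamma> t \<Longrightarrow> producible T \<tau> \<gamma>"
  using root_in_node_labels[of t] by (auto simp: assembly_tree_def)

lemma producible_has_assembly_tree: "producible T \<tau> \<alpha> \<Longrightarrow> \<exists>t. assembly_tree T \<tau> \<alpha> t"
proof (induction rule: producible.induct)
  case (single \<alpha>)
  then show ?case
    using well_labeled_imp_assembly_tree[of T \<tau> "Leaf \<alpha>"] by auto
next
  case (union \<alpha> \<beta> \<gamma>)
  then have "combines T \<tau> \<alpha> \<beta> \<gamma>"
    by (simp add: combines_def)
  with union.IH show ?case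
    using assembly_tree_Node by blast
qed

section \<open>Consistency of unions\<close>

lemma consistent_map_le: "consistent \<alpha> \<beta> \<Longrightarrow> \<alpha> \<subseteq>\<^sub>m \<alpha> ++ \<beta>"
  by (auto simp: consistent_def map_le_def map_add_def split: option.splits)
    (metis IntI domI option.inject)

lemma consistent_iff:
  "consistent \<alpha> \<beta> \<longleftrightarrow> (\<forall>p s t. \<alpha> p = Some s \<longrightarrow> \<beta> p = Some t \<longrightarrow> s = t)"
  by (force simp: consistent_def Ball_def domIff)

text \<open>Here \<delta> and \<epsilon> stand for the two children of an assembly. By disjointness
  \<open>\<delta> ++ \<epsilon>\<close> extends both of them, and \<delta> cannot conflict with
  \<epsilon>, so any conflict would already be one between \<alpha> and
  \<open>\<delta> ++ \<epsilon>\<close>.\<close>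

lemma consistent_disjoint_split:
  assumes "consistent \<alpha> (\<delta> ++ \<epsilon>)" "dom \<delta> \<inter> dom \<epsilon> = {}"
  shows "consistent \<alpha> \<delta>" "consistent (\<alpha> ++ \<delta>) \<epsilon>" "consistent (\<alpha> ++ \<delta>) (\<delta> ++ \<epsilon>)"
proof -
  have disj: "\<delta> p = None \<or> \<epsilon> p = None" for p
    using assms(2) by blast
  have agree: "\<alpha> p = Some s \<Longrightarrow> (\<delta> ++ \<epsilon>) p = Some t \<Longrightarrow> s = t" for p s t
    by (rule assms(1)[unfolded consistent_iff, rule_format])
  show "consistent \<alpha> \<delta>"
    unfolding consistent_iff
  proof (intro allI impI)
    fix p s t assume "\<alpha> p = Some s" "\<delta> p = Some t"
    then show "s = t"
      using agree[of p s t] disj[of p] by (auto simp: map_add_def split: option.splits)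
  qed
  show "consistent (\<alpha> ++ \<delta>) \<epsilon>"
    unfolding consistent_iff
  proof (intro allI impI)
    fix p s t assume "(\<alpha> ++ \<delta>) p = Some s" "\<epsilon> p = Some t"
    then show "s = t"
      using agree[of p s t] disj[of p] by (auto simp: map_add_def split: option.splits)
  qed
  show "consistent (\<alpha> ++ \<delta>) (\<delta> ++ \<epsilon>)"
    unfolding consistent_iff
  proof (intro allI impI)
    fix p s t assume "(\<alpha> ++ \<delta>) p = Some s" "(\<delta> ++ \<epsilon>) p = Some t"
    then show "s = t"
      using agree[of p s t] disj[of p] by (auto simp: map_add_def split: option.splits)
  qed
qed

text \<open>Inclusion of node labels is transitive, so it survives two successive growth steps, and
  \<alpha> remains a node. The induction generalizes \<alpha> and t because the second step starts
  from the enlarged assembly and its new tree.\<close>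

lemma assembly_tree_grow:
  assumes "producible T \<tau> \<beta>" "assembly_tree T \<tau> \<alpha> t"
    and "consistent \<alpha> \<beta>" "dom \<alpha> \<inter> dom \<beta> \<noteq> {}"
  shows "\<exists>t'. assembly_tree T \<tau> (\<alpha> ++ \<beta>) t' \<and> node_labels t \<subseteq> node_labels t'"
  using assms
proof (induction arbitrary: \<alpha> t rule: producible.induct)
  case (single \<beta>)
  then obtain p u where \<beta>: "\<beta> = [p \<mapsto> u]"
    unfolding single_tile_def by blast
  \<comment> \<open>A single tile that overlaps \<alpha> consistently is already part of \<alpha>,
    so t itself serves.\<close>
  then have "dom \<beta> = {p}"
    by simp
  then have "p \<in> dom \<alpha> \<inter> dom \<beta>"
    using single.prems(3) by (cases "p \<in> dom \<alpha>") simp_all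
  with single.prems(2) have "\<alpha> p = \<beta> p"
    unfolding consistent_def by (rule bspec)
  then have "\<alpha> ++ \<beta> = \<alpha>"
    by (simp add: \<beta> fun_upd_idem)
  with single show ?case
    by auto
next
  case (union \<beta>1 \<beta>2 \<beta>)
  have \<beta>: "producible T \<tau> \<beta>"
    using union.hyps by (blast intro: producible.union)
  \<comment> \<open>The roles of the children are left open, with both induction hypotheses as
    premises, so that the argument applies in either order: \<delta> is a child that meets
    \<alpha>.\<close>
  have grow: "\<exists>t'. assembly_tree T \<tau> (\<alpha> ++ \<beta>) t' \<and> node_labels t \<subseteq> node_labels t'"
    if split: "\<beta> = \<delta> ++ \<epsilon>" "dom \<delta> \<inter> dom \<epsilon> = {}"
      and overlap: "dom \<alpha> \<inter> dom \<delta> \<noteq> {}"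
      and \<epsilon>: "producible T \<tau> \<epsilon>"
      and IH\<delta>: "\<And>\<alpha> t. \<lbrakk>assembly_tree T \<tau> \<alpha> t; consistent \<alpha> \<delta>; dom \<alpha> \<inter> dom \<delta> \<noteq> {}\<rbrakk> \<Longrightarrow>
        \<exists>t'. assembly_tree T \<tau> (\<alpha> ++ \<delta>) t' \<and> node_labels t \<subseteq> node_labels t'"
      and IH\<epsilon>: "\<And>\<alpha> t. \<lbrakk>assembly_tree T \<tau> \<alpha> t; consistent \<alpha> \<epsilon>; dom \<alpha> \<inter> dom \<epsilon> \<noteq> {}\<rbrakk> \<Longrightarrow>
        \<exists>t'. assembly_tree T \<tau> (\<alpha> ++ \<epsilon>) t' \<and> node_labels t \<subseteq> node_labels t'"
    for \<delta> \<epsilon>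
  proof -
    have cons: "consistent \<alpha> \<delta>" "consistent (\<alpha> ++ \<delta>) \<epsilon>" "consistent (\<alpha> ++ \<delta>) \<beta>"
      using consistent_disjoint_split[OF union.prems(2)[unfolded split(1)] split(2)]
      by (simp_all add: split(1))
    have \<gamma>: "\<alpha> ++ \<beta> = (\<alpha> ++ \<delta>) ++ \<epsilon>"
      by (simp add: split)
    obtain t1 where t1: "assembly_tree T \<tau> (\<alpha> ++ \<delta>) t1" "node_labels t \<subseteq> node_labels t1"
      using IH\<delta>[OF union.prems(1) cons(1) overlap] by blast
    show ?thesis
    proof (cases "dom (\<alpha> ++ \<delta>) \<inter> dom \<epsilon> = {}")
      case True
      have p: "producible T \<tau> (\<alpha> ++ \<delta>)"
        using t1(1) by (rule assembly_tree_producible)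
      \<comment> \<open>The tree attaches \<epsilon>, which is disjoint from
        \<open>\<alpha> ++ \<delta>\<close>. Connectedness and stability instead view the result as
        a union with all of \<beta>, which shares \<open>dom \<delta>\<close> with
        \<open>\<alpha> ++ \<delta>\<close>.\<close>
      have dom: "dom (\<alpha> ++ \<beta>) = dom (\<alpha> ++ \<delta>) \<union> dom \<beta>" "dom (\<alpha> ++ \<delta>) \<inter> dom \<beta> \<noteq> {}"
        using overlap by (auto simp: split)
      have "assembly (\<alpha> ++ \<beta>)"
        using assembly_overlapping_union[OF dom] p \<beta> producible_assembly by blast
      moreover have "stable \<tau> (\<alpha> ++ \<beta>)"
      proof (rule stable_overlapping_union[OF _ _ dom(1) _ dom(2)])
        show "\<alpha> ++ \<delta> \<subseteq>\<^sub>m \<alpha> ++ \<beta>"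
          using consistent_map_le[OF cons(2)] by (simp add: \<gamma>)
        show "finite (dom (\<alpha> ++ \<beta>))"
          unfolding dom(1) using p \<beta> producible_finite by blast
      qed (use p \<beta> producible_stable in auto)
      ultimately have "combines T \<tau> (\<alpha> ++ \<delta>) \<epsilon> (\<alpha> ++ \<beta>)"
        using p \<epsilon> True \<gamma> by (simp add: combines_def)
      moreover obtain t2 where "assembly_tree T \<tau> \<epsilon> t2"
        using producible_has_assembly_tree[OF \<epsilon>] by blast
      \<comment> \<open>The left subtree t1 retains every label of t; any tree of \<epsilon> will do
        on the right.\<close>
      ultimately have "assembly_tree T \<tau> (\<alpha> ++ \<beta>) (Node (\<alpha> ++ \<beta>) t1 t2)"
        using t1(1) by (blast intro: assembly_tree_Node)
      with t1(2) show ?thesis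
        by (intro exI[of _ "Node (\<alpha> ++ \<beta>) t1 t2"]) auto
    next
      case False
      obtain t2 where t2: "assembly_tree T \<tau> (\<alpha> ++ \<delta> ++ \<epsilon>) t2" "node_labels t1 \<subseteq> node_labels t2"
        using IH\<epsilon>[OF t1(1) cons(2) False] by (elim exE conjE)
      show ?thesis
        unfolding \<gamma> by (intro exI[of _ t2] conjI t2(1) order.trans[OF t1(2) t2(2)])
    qed
  qed
  show ?case
  proof (cases "dom \<alpha> \<inter> dom \<beta>1 = {}")
    case True
    then have "dom \<alpha> \<inter> dom \<beta>2 \<noteq> {}"
      using union.prems(3) by (simp add: \<open>\<beta> = \<beta>1 ++ \<beta>2\<close> Int_Un_distrib)
    moreover have "\<beta> = \<beta>2 ++ \<beta>1"
      \<comment> \<open>Disjointness makes \<open>++\<close> commute, so the child meeting \<alpha>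
        can be put first.\<close>
      unfolding \<open>\<beta> = \<beta>1 ++ \<beta>2\<close> using union.hyps(3) by (rule map_add_comm)
    moreover have "dom \<beta>2 \<inter> dom \<beta>1 = {}"
      using union.hyps(3) by (simp add: Int_commute)
    ultimately show ?thesis
      using union.hyps(1) union.IH by (intro grow[of \<beta>2 \<beta>1]) assumption+
  next
    case False
    then show ?thesis
      using union.hyps(2-4) union.IH by (intro grow[of \<beta>1 \<beta>2]) assumption+
  qed
qed

theorem theorem5p1:
  fixes T :: "'l tile set" and \<tau> :: nat and \<alpha> \<beta> :: "'l placement"
  assumes "hierarchical_TAS T \<tau>"
    and "producible T \<tau> \<alpha>" and "producible T \<tau> \<beta>"
    and "consistent \<alpha> \<beta>"
    and "dom \<alpha> \<inter> dom \<beta> \<noteq> {}"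
  shows "producible T \<tau> (\<alpha> ++ \<beta>) \<and> assembles_to T \<tau> \<alpha> (\<alpha> ++ \<beta>)"
proof -
  \<comment> \<open>Any tree of \<alpha> can be the start: its root label \<alpha> persists in the
    grown tree.\<close>
  obtain t where t: "assembly_tree T \<tau> \<alpha> t"
    using producible_has_assembly_tree[OF assms(2)] by blast
  then have "\<alpha> \<in> node_labels t"
    using root_in_node_labels[of t] by (simp add: assembly_tree_def)
  moreover obtain t' where "assembly_tree T \<tau> (\<alpha> ++ \<beta>) t'" "node_labels t \<subseteq> node_labels t'"
    using assembly_tree_grow[OF assms(3) t assms(4,5)] by blast
  ultimately show ?thesis
    using assembly_tree_producible unfolding assembles_to_def by blast
qed

end
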